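(* The covering type of the real projective plane $\mathbb{RP}^2$ is $6$, i.e. $ct(\mathbb{RP}^2)=6$.
   Context: A good (open) cover of a topological space $X$ is a family of contractible open subspaces $U_i$ covering $X$ such that every nonempty intersection $U_{i_1}\cap\dots\cap U_{i_n}$ is contractible. The strict covering type of $X$ is the minimum number of elements in a good open cover of $X$. The covering type $ct(X)$ is the minimum of the strict covering types of spaces $X'$ homotopy equivalent to $X$. *)

theory Defs
  imports "HOL-Analysis.Analysis" "HOL-Library.Extended_Nat"
begin

text \<open>
  The library predicate \<^const>\<open>contractible_space\<close> holds of the empty space; the usual convention,
  adopted here, is that a contractible space is nonempty, so nonemptiness is required separately.
\<close>

definition good_cover :: "'a topology \<Rightarrow> 'a set set \<Rightarrow> bool" where
  "good_cover X \<U> \<longleftrightarrow>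
     (\<forall>U\<in>\<U>. openin X U \<and> U \<noteq> {} \<and> contractible_space (subtopology X U)) \<and>
     \<Union>\<U> = topspace X \<and>
     (\<forall>\<F>. \<F> \<subseteq> \<U> \<and> finite \<F> \<and> \<F> \<noteq> {} \<and> \<Inter>\<F> \<noteq> {} \<longrightarrow>
          contractible_space (subtopology X (\<Inter>\<F>)))"

text \<open>
  In \<^typ>\<open>enat\<close> the infimum of a nonempty set is its least element, and the infimum of the empty
  set is \<open>\<infinity>\<close>.  So a finite value is always an attained minimum, and \<open>\<infinity>\<close> means that there is no
  finite good cover.
\<close>

definition strict_covering_type :: "'a topology \<Rightarrow> enat" where
  "strict_covering_type X = Inf {enat (card \<U>) | \<U>. finite \<U> \<and> good_cover X \<U>}"

text \<open>
  A definition cannot range over spaces of all types at once, so the type \<open>'b\<close> of the points of the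
  competing spaces \<open>X'\<close> is a parameter.
\<close>

definition covering_type :: "'b itself \<Rightarrow> 'a topology \<Rightarrow> enat" where
  "covering_type (_ :: 'b itself) X =
     Inf {strict_covering_type X' | X' :: 'b topology. X' homotopy_equivalent_space X}"

definition antipodal_class :: "real^3 \<Rightarrow> (real^3) set" where
  "antipodal_class x = {x, - x}"

text \<open>The quotient of the unit sphere of \<open>\<real>\<^sup>3\<close> by the antipodal map, with the quotient topology.\<close>

definition real_projective_plane :: "(real^3) set topology" where
  "real_projective_plane = topology (\<lambda>V. V \<subseteq> antipodal_class ` sphere 0 1 \<and>
     openin (top_of_set (sphere 0 1)) {x \<in> sphere 0 1. antipodal_class x \<in> V})"

lemma openin_real_projective_plane:
  "openin real_projective_plane V \<longleftrightarrow> V \<subseteq> antipodal_class ` sphere 0 1 \<and>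
     openin (top_of_set (sphere 0 1)) {x \<in> sphere 0 1. antipodal_class x \<in> V}"
proof -
  let ?O = "\<lambda>V. V \<subseteq> antipodal_class ` sphere 0 1 \<and>
     openin (top_of_set (sphere 0 1)) {x \<in> sphere 0 1. antipodal_class x \<in> V}"
  have "?O (S \<inter> T)" if "?O S" "?O T" for S T
  proof -
    have "{x \<in> sphere 0 1. antipodal_class x \<in> S \<inter> T} =
        {x \<in> sphere 0 1. antipodal_class x \<in> S} \<inter> {x \<in> sphere 0 1. antipodal_class x \<in> T}"
      by blast
    then show ?thesis
      using that by (metis (no_types, lifting) inf.coboundedI1 openin_Int)
  qed
  moreover have "?O (\<Union>\<K>)" if "\<forall>K\<in>\<K>. ?O K" for \<K>
  proof -
    have "{x \<in> sphere 0 1. antipodal_class x \<in> \<Union>\<K>} =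
        (\<Union>K\<in>\<K>. {x \<in> sphere 0 1. antipodal_class x \<in> K})"
      by blast
    moreover have "openin (top_of_set (sphere 0 1))
        (\<Union>K\<in>\<K>. {x \<in> sphere 0 1. antipodal_class x \<in> K})"
      using that by blast
    ultimately show ?thesis
      using that by (simp add: Union_least)
  qed
  ultimately have "istopology ?O"
    unfolding istopology_def by blast
  then show ?thesis
    unfolding real_projective_plane_def by (simp add: topology_inverse')
qed

lemma quotient_map_antipodal_class:
  "quotient_map (top_of_set (sphere 0 1)) real_projective_plane antipodal_class"
proof -
  have "{x \<in> sphere 0 1. antipodal_class x \<in> antipodal_class ` sphere 0 1} = sphere 0 1"
    by blast
  then have "openin real_projective_plane (antipodal_class ` sphere 0 1)"
    unfolding openin_real_projective_plane by simp
  then have "topspace real_projective_plane = antipodal_class ` sphere 0 1"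
    by (metis openin_real_projective_plane openin_subset openin_topspace subset_antisym)
  then show ?thesis
    by (simp add: quotient_map_def openin_real_projective_plane)
qed

lemma antipodal_class_eq_iff: "antipodal_class x = antipodal_class y \<longleftrightarrow> x = y \<or> x = - y"
  by (auto simp: antipodal_class_def doubleton_eq_iff)

end

theory Submission
  imports Defs
begin

text \<open>
  Lower bound: liftability of a map \<open>Y \<rightarrow> \<real>P\<^sup>2\<close> to \<open>S\<^sup>2\<close> is a homotopy invariant, so it holds on
  contractible \<open>Y\<close>, and it passes from two open sets with connected intersection to their union.
  If \<open>f : X \<rightarrow> \<real>P\<^sup>2\<close> has a right homotopy inverse, a finite open cover of \<open>X\<close> by sets on which \<open>f\<close>
  lifts and no three of which meet would yield an odd nonvanishing map \<open>S\<^sup>2 \<rightarrow> \<complex>\<close>, which does not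
  exist.  Hence some point lies in three members of a good cover of \<open>X\<close>.  The members through that
  point have a union on which \<open>f\<close> lifts, and if at most two members were left, \<open>f\<close> would lift on their
  union as well.  These two unions would be a cover of the forbidden kind.

  Upper bound: the six pairs of opposite vertices of an icosahedron are the centres of six circular
  caps of \<open>\<real>P\<^sup>2\<close> which can be made large enough to cover it but so small that the lifts to the
  sphere of any intersecting family can be chosen consistently.  An intersection of caps is then
  geodesically convex.
\<close>

section \<open>Lifting through covering maps\<close>

definition evenly_covered :: "'e topology \<Rightarrow> 'b topology \<Rightarrow> ('e \<Rightarrow> 'b) \<Rightarrow> 'b set \<Rightarrow> bool" where
  "evenly_covered E B p U \<longleftrightarrow>
     openin B U \<and>
     (\<exists>\<V>. \<Union>\<V> = {e \<in> topspace E. p e \<in> U} \<and> pairwise disjnt \<V> \<and>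
        (\<forall>V\<in>\<V>. openin E V \<and> homeomorphic_map (subtopology E V) (subtopology B U) p))"

definition covering_map :: "'e topology \<Rightarrow> 'b topology \<Rightarrow> ('e \<Rightarrow> 'b) \<Rightarrow> bool" where
  "covering_map E B p \<longleftrightarrow>
     continuous_map E B p \<and> p ` topspace E = topspace B \<and>
     (\<forall>b\<in>topspace B. \<exists>U. b \<in> U \<and> evenly_covered E B p U)"

definition is_lift :: "'e topology \<Rightarrow> ('e \<Rightarrow> 'b) \<Rightarrow> 'y topology \<Rightarrow> ('y \<Rightarrow> 'b) \<Rightarrow> ('y \<Rightarrow> 'e) \<Rightarrow> bool" where
  "is_lift E p Y f s \<longleftrightarrow> continuous_map Y E s \<and> (\<forall>y\<in>topspace Y. p (s y) = f y)"

definition liftable :: "'e topology \<Rightarrow> ('e \<Rightarrow> 'b) \<Rightarrow> 'y topology \<Rightarrow> ('y \<Rightarrow> 'b) \<Rightarrow> bool" where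
  "liftable E p Y f \<longleftrightarrow> (\<exists>s. is_lift E p Y f s)"

lemma evenly_covered_nbhd:
  assumes "covering_map E B p" "b \<in> topspace B"
  obtains U where "b \<in> U" "evenly_covered E B p U"
  using assms unfolding covering_map_def by blast

lemma is_lift_compose:
  assumes "is_lift E p Y f s" "continuous_map Z Y g"
  shows "is_lift E p Z (\<lambda>z. f (g z)) (\<lambda>z. s (g z))"
  using assms continuous_map_compose[of Z Y g E s] continuous_map_funspace[of Z Y g]
  unfolding is_lift_def by (auto simp: o_def Pi_iff)

lemma is_lift_subtopology: "is_lift E p Y f s \<Longrightarrow> is_lift E p (subtopology Y S) f s"
  by (simp add: is_lift_def continuous_map_from_subtopology)

lemma evenly_covered_sections:
  assumes "evenly_covered E B p U"
  obtains \<V> q where "\<Union>\<V> = {e \<in> topspace E. p e \<in> U}" "pairwise disjnt \<V>"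
    "\<forall>V\<in>\<V>. openin E V" "\<forall>V\<in>\<V>. continuous_map (subtopology B U) E (q V)"
    "\<forall>V\<in>\<V>. \<forall>b\<in>U. p (q V b) = b" "\<forall>V\<in>\<V>. \<forall>e\<in>V. q V (p e) = e"
proof -
  obtain \<V> where U: "openin B U" and \<V>: "\<Union>\<V> = {e \<in> topspace E. p e \<in> U}" "pairwise disjnt \<V>"
    "\<forall>V\<in>\<V>. openin E V" "\<forall>V\<in>\<V>. homeomorphic_map (subtopology E V) (subtopology B U) p"
    using assms unfolding evenly_covered_def by auto
  then obtain q where q: "\<And>V. V \<in> \<V> \<Longrightarrow> homeomorphic_maps (subtopology E V) (subtopology B U) p (q V)"
    unfolding homeomorphic_map_maps by metis
  have "\<forall>V\<in>\<V>. continuous_map (subtopology B U) E (q V)"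
    using q by (auto simp: homeomorphic_maps_def continuous_map_in_subtopology)
  moreover have "\<forall>V\<in>\<V>. \<forall>b\<in>U. p (q V b) = b"
    using q openin_subset[OF U] by (auto simp: homeomorphic_maps_def)
  moreover have "\<forall>V\<in>\<V>. \<forall>e\<in>V. q V (p e) = e"
    using q \<V>(3) openin_subset[of E] by (fastforce simp: homeomorphic_maps_def)
  ultimately show ?thesis
    by (rule that[OF \<V>(1-3)])
qed

lemma lifts_agree_or_differ_near:
  assumes p: "covering_map E B p" and s: "is_lift E p Y f s" and t: "is_lift E p Y f t"
    and y: "y \<in> topspace Y"
  obtains N where "openin Y N" "y \<in> N" "(\<forall>z\<in>N. s z = t z) \<or> (\<forall>z\<in>N. s z \<noteq> t z)"
proof -
  have sy: "s y \<in> topspace E" and ty: "t y \<in> topspace E" and eq: "p (s y) = p (t y)"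
    using s t y unfolding is_lift_def by (auto dest: continuous_map_funspace)
  moreover have "p (s y) \<in> topspace B"
    using p sy by (auto simp: covering_map_def)
  ultimately obtain U where U: "p (s y) \<in> U" "evenly_covered E B p U"
    using evenly_covered_nbhd[OF p] by blast
  obtain \<V> q where \<V>: "\<Union>\<V> = {e \<in> topspace E. p e \<in> U}" "pairwise disjnt \<V>"
      "\<forall>V\<in>\<V>. openin E V"
    and q: "\<forall>V\<in>\<V>. \<forall>e\<in>V. q V (p e) = e"
    by (rule evenly_covered_sections[OF U(2)])
  obtain V W where VW: "V \<in> \<V>" "s y \<in> V" "W \<in> \<V>" "t y \<in> W"
    using \<V>(1) sy ty eq U(1) by (metis (mono_tags, lifting) UnionE mem_Collect_eq)
  define N where "N = {z \<in> topspace Y. s z \<in> V} \<inter> {z \<in> topspace Y. t z \<in> W}"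
  have "openin Y N"
    using s t VW \<V>(3) unfolding N_def is_lift_def
    by (intro openin_Int openin_continuous_map_preimage) auto
  moreover have "y \<in> N"
    using y VW by (simp add: N_def)
  moreover have "s z = t z" if "V = W" "z \<in> N" for z
  proof -
    have "s z \<in> V" "t z \<in> V" "p (s z) = p (t z)"
      using s t that by (auto simp: N_def is_lift_def)
    then show ?thesis
      using q VW(1) by metis
  qed
  moreover have "s z \<noteq> t z" if "V \<noteq> W" "z \<in> N" for z
    using that pairwiseD[OF \<V>(2) VW(1,3)] by (auto simp: N_def disjnt_iff)
  ultimately show ?thesis
    using that by blast
qed

lemma lift_unique:
  assumes p: "covering_map E B p" and s: "is_lift E p Y f s" and t: "is_lift E p Y f t"
    and Y: "connected_space Y" and a: "a \<in> topspace Y" "s a = t a" and y: "y \<in> topspace Y"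
  shows "s y = t y"
proof -
  let ?A = "{y \<in> topspace Y. s y = t y}"
  have nbhd: "\<exists>N. openin Y N \<and> y \<in> N \<and> (N \<subseteq> ?A \<or> N \<subseteq> topspace Y - ?A)" if y: "y \<in> topspace Y" for y
  proof -
    obtain N where "openin Y N" "y \<in> N" "(\<forall>z\<in>N. s z = t z) \<or> (\<forall>z\<in>N. s z \<noteq> t z)"
      by (rule lifts_agree_or_differ_near[OF p s t y])
    then show ?thesis
      using openin_subset[of Y N] by blast
  qed
  have "openin Y ?A"
    by (subst openin_subopen) (use nbhd in blast)
  moreover have "openin Y (topspace Y - ?A)"
    by (subst openin_subopen) (use nbhd in blast)
  ultimately have "?A = {} \<or> ?A = topspace Y"
    using Y unfolding connected_space_clopen_in closedin_def by blast
  then show ?thesis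
    using a y by blast
qed

lemma lift_along_sheets:
  assumes U: "evenly_covered E B p U"
    and H: "continuous_map X B H" "\<And>x. x \<in> topspace X \<Longrightarrow> H x \<in> U"
    and r: "continuous_map X E r" "\<And>x. x \<in> topspace X \<Longrightarrow> p (r x) \<in> U"
  obtains K where "is_lift E p X H K" "\<And>x. x \<in> topspace X \<Longrightarrow> p (r x) = H x \<Longrightarrow> K x = r x"
proof -
  obtain \<V> q where \<V>: "\<Union>\<V> = {e \<in> topspace E. p e \<in> U}" "pairwise disjnt \<V>"
      "\<forall>V\<in>\<V>. openin E V"
    and q: "\<forall>V\<in>\<V>. continuous_map (subtopology B U) E (q V)"
      "\<forall>V\<in>\<V>. \<forall>b\<in>U. p (q V b) = b" "\<forall>V\<in>\<V>. \<forall>e\<in>V. q V (p e) = e"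
    by (rule evenly_covered_sections[OF U])
  define T where "T V = {x \<in> topspace X. r x \<in> V}" for V
  have sheet: "\<exists>V\<in>\<V>. x \<in> T V" if "x \<in> topspace X" for x
  proof -
    have "r x \<in> \<Union>\<V>"
      using that r continuous_map_funspace[OF r(1)] unfolding \<V>(1) by auto
    then show ?thesis
      using that by (auto simp: T_def)
  qed
  obtain K where K: "continuous_map X E K"
    "\<And>x V. V \<in> \<V> \<Longrightarrow> x \<in> topspace X \<inter> T V \<Longrightarrow> K x = q V (H x)"
  proof (rule pasting_lemma_exists)
    show "topspace X \<subseteq> (\<Union>V\<in>\<V>. T V)"
      using sheet by blast
    show "openin X (T V)" if "V \<in> \<V>" for V
      unfolding T_def using that \<V>(3) by (intro openin_continuous_map_preimage[OF r(1)]) blast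
    have H_U: "continuous_map X (subtopology B U) H"
      using H by (auto intro: continuous_map_into_subtopology)
    show "continuous_map (subtopology X (T V)) E (\<lambda>x. q V (H x))" if "V \<in> \<V>" for V
      using continuous_map_compose[OF continuous_map_from_subtopology[OF H_U] bspec[OF q(1) that]]
      by (simp add: o_def)
    show "q V (H x) = q W (H x)" if "V \<in> \<V>" "W \<in> \<V>" "x \<in> topspace X \<inter> T V \<inter> T W" for V W x
      using that pairwiseD[OF \<V>(2) that(1,2)] by (force simp: T_def disjnt_iff)
  qed blast
  have "p (K x) = H x \<and> (p (r x) = H x \<longrightarrow> K x = r x)" if x: "x \<in> topspace X" for x
  proof -
    obtain V where V: "V \<in> \<V>" "x \<in> T V"
      using sheet[OF x] by blast
    moreover have "p (q V (H x)) = H x" "q V (p (r x)) = r x"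
      using q(2,3) V H(2)[OF x] by (auto simp: T_def)
    ultimately show ?thesis
      using K(2)[of V x] x by auto
  qed
  then show ?thesis
    using that K(1) unfolding is_lift_def by blast
qed

lemma prod_topology_top_of_set_subset:
  assumes "S \<subseteq> T"
  shows "prod_topology (top_of_set S) Y = subtopology (prod_topology (top_of_set T) Y)
           {z \<in> topspace (prod_topology (top_of_set T) Y). fst z \<in> S}"
  unfolding prod_topology_subtopology subtopology_subtopology using assms
  by (intro arg_cong2[where f = subtopology]) auto

lemma is_lift_concat:
  fixes a b c :: real
  assumes ab: "a \<le> b" "b \<le> c"
    and K: "is_lift E p (prod_topology (top_of_set {a..b}) Y) H K"
    and L: "is_lift E p (prod_topology (top_of_set {b..c}) Y) H L"
    and agree: "\<And>y. y \<in> topspace Y \<Longrightarrow> K (b, y) = L (b, y)"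
  shows "is_lift E p (prod_topology (top_of_set {a..c}) Y) H (\<lambda>z. if fst z \<le> b then K z else L z)"
proof -
  let ?X = "\<lambda>S. prod_topology (top_of_set S) Y"
  have "continuous_map (?X {a..c}) E (\<lambda>z. if fst z \<le> b then K z else L z)"
  proof (rule continuous_map_cases_le)
    show "continuous_map (?X {a..c}) euclideanreal fst"
      by (rule continuous_map_into_fulltopology[OF continuous_map_fst])
    have "{z \<in> topspace (?X {a..c}). fst z \<le> b} = {z \<in> topspace (?X {a..c}). fst z \<in> {a..b}}"
      by auto
    then show "continuous_map (subtopology (?X {a..c}) {z \<in> topspace (?X {a..c}). fst z \<le> b}) E K"
      using K ab prod_topology_top_of_set_subset[of "{a..b}" "{a..c}" Y] by (simp add: is_lift_def)
    have "{z \<in> topspace (?X {a..c}). b \<le> fst z} = {z \<in> topspace (?X {a..c}). fst z \<in> {b..c}}"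
      using ab by auto
    then show "continuous_map (subtopology (?X {a..c}) {z \<in> topspace (?X {a..c}). b \<le> fst z}) E L"
      using L ab prod_topology_top_of_set_subset[of "{b..c}" "{a..c}" Y] by (simp add: is_lift_def)
  qed (use agree in auto)
  then show ?thesis
    using K L by (auto simp: is_lift_def)
qed

lemma homotopy_lift_extend:
  fixes a b c :: real
  assumes ab: "a \<le> b" "b \<le> c"
    and U: "evenly_covered E B p U"
    and H: "continuous_map (prod_topology (top_of_set {a..c}) Y) B H"
      "\<And>t y. t \<in> {b..c} \<Longrightarrow> y \<in> topspace Y \<Longrightarrow> H (t, y) \<in> U"
    and K: "is_lift E p (prod_topology (top_of_set {a..b}) Y) H K"
  obtains L where "is_lift E p (prod_topology (top_of_set {a..c}) Y) H L"
    "\<And>y. y \<in> topspace Y \<Longrightarrow> L (a, y) = K (a, y)"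
proof -
  let ?X = "\<lambda>S. prod_topology (top_of_set S) Y"
  have "continuous_map (?X {b..c}) (?X {a..b}) (\<lambda>z. (b, snd z))"
    using ab by (intro continuous_map_pairedI continuous_map_snd) auto
  from is_lift_compose[OF K this]
  have K_b: "is_lift E p (?X {b..c}) (\<lambda>z. H (b, snd z)) (\<lambda>z. K (b, snd z))" .
  have H_late: "continuous_map (?X {b..c}) B H"
    using ab by (subst prod_topology_top_of_set_subset[of _ "{a..c}"])
      (auto intro: continuous_map_from_subtopology[OF H(1)])
  obtain M where M: "is_lift E p (?X {b..c}) H M"
    "\<And>z. z \<in> topspace (?X {b..c}) \<Longrightarrow> p (K (b, snd z)) = H z \<Longrightarrow> M z = K (b, snd z)"
  proof (rule lift_along_sheets[OF U H_late, of "\<lambda>z. K (b, snd z)"])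
    show "H z \<in> U" if "z \<in> topspace (?X {b..c})" for z
      using that H(2) by auto
    show "p (K (b, snd z)) \<in> U" if "z \<in> topspace (?X {b..c})" for z
      using that H(2)[of b "snd z"] ab K_b by (auto simp: is_lift_def)
  qed (use K_b in \<open>auto simp: is_lift_def\<close>)
  have "K (b, y) = M (b, y)" if "y \<in> topspace Y" for y
    using M(2)[of "(b, y)"] K ab that by (simp add: is_lift_def)
  then have "is_lift E p (?X {a..c}) H (\<lambda>z. if fst z \<le> b then K z else M z)"
    by (rule is_lift_concat[OF ab K M(1)])
  then show ?thesis
    by (rule that) (simp add: ab)
qed

lemma evenly_covered_tube:
  assumes p: "covering_map E B p" and H: "continuous_map (prod_topology (top_of_set S) Y) B H"
    and x: "x \<in> S" and y: "y \<in> topspace Y"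
  obtains U d M where "evenly_covered E B p U" "d > 0" "openin Y M" "y \<in> M"
    "\<And>t z. t \<in> S \<Longrightarrow> dist x t < d \<Longrightarrow> z \<in> M \<Longrightarrow> H (t, z) \<in> U"
proof -
  let ?X = "prod_topology (top_of_set S) Y"
  have "H (x, y) \<in> topspace B"
    using continuous_map_funspace[OF H] x y by auto
  then obtain U where U: "H (x, y) \<in> U" "evenly_covered E B p U"
    by (rule evenly_covered_nbhd[OF p])
  then have "openin ?X {z \<in> topspace ?X. H z \<in> U}"
    by (intro openin_continuous_map_preimage[OF H]) (simp add: evenly_covered_def)
  moreover have "(x, y) \<in> {z \<in> topspace ?X. H z \<in> U}"
    using x y U(1) by simp
  ultimately obtain T M where T: "openin (top_of_set S) T" "x \<in> T" and M: "openin Y M" "y \<in> M"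
    and TM: "T \<times> M \<subseteq> {z \<in> topspace ?X. H z \<in> U}"
    unfolding openin_prod_topology_alt by meson
  obtain d where d: "d > 0" "ball x d \<inter> S \<subseteq> T"
    using T by (meson openin_contains_ball)
  have "H (t, z) \<in> U" if "t \<in> S" "dist x t < d" "z \<in> M" for t z
  proof -
    have "t \<in> T"
      using that d(2) by auto
    then show ?thesis
      using that(3) TM by blast
  qed
  then show ?thesis
    using that[OF U(2) d(1) M] by blast
qed

definition homotopy_lifts_near ::
  "'e topology \<Rightarrow> ('e \<Rightarrow> 'b) \<Rightarrow> 'y topology \<Rightarrow> (real \<times> 'y \<Rightarrow> 'b) \<Rightarrow> ('y \<Rightarrow> 'e) \<Rightarrow> 'y \<Rightarrow> real \<Rightarrow> bool" where
  "homotopy_lifts_near E p Y H s y b \<longleftrightarrow>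
     (\<exists>N K. openin Y N \<and> y \<in> N \<and> (\<forall>z\<in>N. K (0, z) = s z) \<and>
        is_lift E p (prod_topology (top_of_set {0..b}) (subtopology Y N)) H K)"

lemma homotopy_lifts_near_0:
  assumes s: "is_lift E p Y (\<lambda>y. H (0, y)) s" and y: "y \<in> topspace Y"
  shows "homotopy_lifts_near E p Y H s y 0"
proof -
  have "is_lift E p (prod_topology (top_of_set {0..0::real}) Y) (\<lambda>z. H (0, snd z)) (\<lambda>z. s (snd z))"
    by (rule is_lift_compose[OF s continuous_map_snd])
  then have "is_lift E p (prod_topology (top_of_set {0..0}) Y) H (\<lambda>z. s (snd z))"
    by (auto simp: is_lift_def)
  then show ?thesis
    unfolding homotopy_lifts_near_def using y
    by (intro exI[of _ "topspace Y"] exI[of _ "\<lambda>z. s (snd z)"]) auto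
qed

lemma homotopy_lifts_near_extend:
  assumes H: "continuous_map (prod_topology (top_of_set {0..1::real}) Y) B H"
    and ab: "0 \<le> a" "a \<le> b" "b \<le> 1"
    and U: "evenly_covered E B p U" and M: "openin Y M" "y \<in> M"
    and HU: "\<And>t z. t \<in> {a..b} \<Longrightarrow> z \<in> M \<Longrightarrow> H (t, z) \<in> U"
    and a: "homotopy_lifts_near E p Y H s y a"
  shows "homotopy_lifts_near E p Y H s y b"
proof -
  obtain N K where N: "openin Y N" "y \<in> N" and K0: "\<And>z. z \<in> N \<Longrightarrow> K (0, z) = s z"
    and K: "is_lift E p (prod_topology (top_of_set {0..a}) (subtopology Y N)) H K"
    using a unfolding homotopy_lifts_near_def by blast
  have "prod_topology (top_of_set {0..a}) (subtopology Y (N \<inter> M))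
      = subtopology (prod_topology (top_of_set {0..a}) (subtopology Y N)) (UNIV \<times> M)"
    by (simp add: subtopology_Times subtopology_subtopology)
  then have K_M: "is_lift E p (prod_topology (top_of_set {0..a}) (subtopology Y (N \<inter> M))) H K"
    using is_lift_subtopology[OF K] by metis
  have "prod_topology (top_of_set {0..b}) (subtopology Y (N \<inter> M))
      = subtopology (prod_topology (top_of_set {0..1}) Y) ({0..b} \<times> (N \<inter> M))"
    using ab(3) by (simp add: subtopology_Times subtopology_subtopology Int_absorb1)
  then have H_b: "continuous_map (prod_topology (top_of_set {0..b}) (subtopology Y (N \<inter> M))) B H"
    by (simp add: continuous_map_from_subtopology[OF H])
  have HU': "H (t, z) \<in> U" if "t \<in> {a..b}" "z \<in> topspace (subtopology Y (N \<inter> M))" for t z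
    using HU that by simp
  obtain L where "is_lift E p (prod_topology (top_of_set {0..b}) (subtopology Y (N \<inter> M))) H L"
    "\<And>z. z \<in> topspace (subtopology Y (N \<inter> M)) \<Longrightarrow> L (0, z) = K (0, z)"
    using homotopy_lift_extend[OF ab(1,2) U H_b HU' K_M] by blast
  then show ?thesis
    unfolding homotopy_lifts_near_def using N M K0 openin_subset[OF N(1)]
    by (intro exI[of _ "N \<inter> M"] exI[of _ L]) auto
qed

lemma homotopy_lifts_near_1:
  assumes p: "covering_map E B p"
    and H: "continuous_map (prod_topology (top_of_set {0..1::real}) Y) B H"
    and s: "is_lift E p Y (\<lambda>y. H (0, y)) s" and y: "y \<in> topspace Y"
  shows "homotopy_lifts_near E p Y H s y 1"
proof -
  let ?lifts = "homotopy_lifts_near E p Y H s y"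
  have "0 \<le> (0::real) \<and> (1::real) \<le> 1 \<longrightarrow> ?lifts 0 \<longrightarrow> ?lifts 1"
  proof (rule Bolzano[where P = "\<lambda>a b. 0 \<le> a \<and> b \<le> 1 \<longrightarrow> ?lifts a \<longrightarrow> ?lifts b"])
    fix x :: real assume x: "0 \<le> x" "x \<le> 1"
    obtain U d M where U: "evenly_covered E B p U" and d: "d > 0" and M: "openin Y M" "y \<in> M"
      and HU: "\<And>t z. t \<in> {0..1} \<Longrightarrow> dist x t < d \<Longrightarrow> z \<in> M \<Longrightarrow> H (t, z) \<in> U"
      using evenly_covered_tube[OF p H _ y, of x] x by auto
    have "?lifts b" if "a \<le> x" "x \<le> b" "b - a < d" "0 \<le> a" "b \<le> 1" "?lifts a" for a b
    proof (rule homotopy_lifts_near_extend[OF H _ _ _ U M])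
      show "H (t, z) \<in> U" if "t \<in> {a..b}" "z \<in> M" for t z
        using that \<open>a \<le> x\<close> \<open>x \<le> b\<close> \<open>b - a < d\<close> \<open>0 \<le> a\<close> \<open>b \<le> 1\<close>
        by (intro HU) (auto simp: dist_real_def)
    qed (use that in auto)
    then show "\<exists>d>0. \<forall>a b. a \<le> x \<and> x \<le> b \<and> b - a < d \<longrightarrow> 0 \<le> a \<and> b \<le> 1 \<longrightarrow> ?lifts a \<longrightarrow> ?lifts b"
      using d by blast
  qed auto
  then show ?thesis
    using homotopy_lifts_near_0[OF s y] by simp
qed

lemma homotopy_lift_unique:
  assumes p: "covering_map E B p"
    and K: "is_lift E p (prod_topology (top_of_set {0..1::real}) Y) H K"
    and L: "is_lift E p (prod_topology (top_of_set {0..1}) Y) H L"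
    and y: "y \<in> topspace Y" "K (0, y) = L (0, y)" and t: "t \<in> {0..1}"
  shows "K (t, y) = L (t, y)"
proof -
  have path: "continuous_map (top_of_set {0..1::real}) (prod_topology (top_of_set {0..1}) Y)
      (\<lambda>t. (t, y))"
    using y(1) by (intro continuous_map_pairedI) auto
  have "connected_space (top_of_set {0..1::real})"
    using connectedin_iff_connected[of "{0..1::real}"] by (simp add: connectedin_def)
  then show ?thesis
    using lift_unique[OF p is_lift_compose[OF K path] is_lift_compose[OF L path], of 0 t] y(2) t by simp
qed

lemma homotopy_lift_paste:
  assumes p: "covering_map E B p"
    and N: "\<And>y. y \<in> topspace Y \<Longrightarrow> openin Y (N y) \<and> y \<in> N y"
    and K: "\<And>y. y \<in> topspace Y \<Longrightarrow>
      is_lift E p (prod_topology (top_of_set {0..1::real}) (subtopology Y (N y))) H (K y)"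
    and K0: "\<And>y z. y \<in> topspace Y \<Longrightarrow> z \<in> N y \<Longrightarrow> K y (0, z) = s z"
  obtains L where "is_lift E p (prod_topology (top_of_set {0..1}) Y) H L"
    "\<And>y. y \<in> topspace Y \<Longrightarrow> L (0, y) = s y"
proof -
  let ?X = "prod_topology (top_of_set {0..1::real}) Y"
  have sub: "prod_topology (top_of_set {0..1}) (subtopology Y M) = subtopology ?X ({0..1} \<times> M)" for M
    by (simp add: prod_topology_subtopology(2))
  have agree: "K x (t, z) = K y (t, z)"
    if xy: "x \<in> topspace Y" "y \<in> topspace Y" and z: "z \<in> topspace Y" "z \<in> N x" "z \<in> N y"
      and t: "t \<in> {0..1}" for x y z t
  proof -
    let ?Z = "prod_topology (top_of_set {0..1::real}) (subtopology Y (N x \<inter> N y))"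
    have "is_lift E p ?Z H (K x)" "is_lift E p ?Z H (K y)"
      using is_lift_subtopology[OF K[OF xy(1)], of "{0..1} \<times> N y"]
        is_lift_subtopology[OF K[OF xy(2)], of "{0..1} \<times> N x"]
      by (simp_all add: sub subtopology_subtopology Times_Int_Times Int_commute)
    from homotopy_lift_unique[OF p this, of z t] show ?thesis
      using xy z t K0 by simp
  qed
  obtain L where L: "continuous_map ?X E L"
    "\<And>w y. y \<in> topspace Y \<Longrightarrow> w \<in> topspace ?X \<inter> {0..1} \<times> N y \<Longrightarrow> L w = K y w"
  proof (rule pasting_lemma_exists)
    show "topspace ?X \<subseteq> (\<Union>y\<in>topspace Y. {0..1} \<times> N y)"
      using N by auto
    show "openin ?X ({0..1} \<times> N y)" if "y \<in> topspace Y" for y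
      using N[OF that] by (simp add: openin_prod_Times_iff)
    show "continuous_map (subtopology ?X ({0..1} \<times> N y)) E (K y)" if "y \<in> topspace Y" for y
      using K[OF that] by (simp add: is_lift_def sub)
    show "K x w = K y w" if "x \<in> topspace Y" "y \<in> topspace Y"
      "w \<in> topspace ?X \<inter> {0..1} \<times> N x \<inter> {0..1} \<times> N y" for x y w
      using agree[OF that(1,2), of "snd w" "fst w"] that(3) by auto
  qed blast
  show ?thesis
  proof
    show "is_lift E p ?X H L"
      using L N K by (auto simp: is_lift_def)
    show "L (0, y) = s y" if "y \<in> topspace Y" for y
      using L(2)[OF that, of "(0, y)"] N[OF that] K0[OF that, of y] that by simp
  qed
qed

theorem homotopy_lift:
  assumes p: "covering_map E B p"
    and H: "continuous_map (prod_topology (top_of_set {0..1::real}) Y) B H"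
    and s: "is_lift E p Y (\<lambda>y. H (0, y)) s"
  obtains K where "is_lift E p (prod_topology (top_of_set {0..1}) Y) H K"
    "\<And>y. y \<in> topspace Y \<Longrightarrow> K (0, y) = s y"
proof -
  obtain N K where N: "\<And>y. y \<in> topspace Y \<Longrightarrow> openin Y (N y) \<and> y \<in> N y"
    and K0: "\<And>y z. y \<in> topspace Y \<Longrightarrow> z \<in> N y \<Longrightarrow> K y (0, z) = s z"
    and K: "\<And>y. y \<in> topspace Y \<Longrightarrow>
      is_lift E p (prod_topology (top_of_set {0..1}) (subtopology Y (N y))) H (K y)"
    using homotopy_lifts_near_1[OF p H s] unfolding homotopy_lifts_near_def by metis
  show ?thesis
    using homotopy_lift_paste[OF p N K K0] that by blast
qed

lemma liftable_compose:
  "liftable E p Y f \<Longrightarrow> continuous_map Z Y g \<Longrightarrow> liftable E p Z (\<lambda>z. f (g z))"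
  unfolding liftable_def by (blast intro: is_lift_compose)

lemma liftable_trivial_topology: "liftable E p trivial_topology f"
  by (simp add: liftable_def is_lift_def)

lemma liftable_homotopic:
  assumes p: "covering_map E B p" and hom: "homotopic_with (\<lambda>_. True) Y B f g"
    and f: "liftable E p Y f"
  shows "liftable E p Y g"
proof -
  obtain H where H: "continuous_map (prod_topology (top_of_set {0..1::real}) Y) B H"
    "\<And>y. H (0, y) = f y" "\<And>y. H (1, y) = g y"
    using hom unfolding homotopic_with_def by auto
  obtain s where "is_lift E p Y (\<lambda>y. H (0, y)) s"
    using f H(2) by (auto simp: liftable_def)
  then obtain K where K: "is_lift E p (prod_topology (top_of_set {0..1}) Y) H K"
    using homotopy_lift[OF p H(1)] by blast
  have "continuous_map Y (prod_topology (top_of_set {0..1}) Y) (\<lambda>y. (1::real, y))"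
    by (intro continuous_map_pairedI) auto
  from is_lift_compose[OF K this] show ?thesis
    unfolding liftable_def H(3) by blast
qed

lemma liftable_contractible_space:
  assumes p: "covering_map E B p" and Y: "contractible_space Y" and f: "continuous_map Y B f"
  shows "liftable E p Y f"
proof (cases "topspace Y = {}")
  case True
  then show ?thesis
    by (simp add: liftable_trivial_topology)
next
  case False
  then obtain a where a: "a \<in> topspace Y" "homotopic_with (\<lambda>_. True) Y Y id (\<lambda>_. a)"
    using Y unfolding contractible_space_alt by blast
  have "homotopic_with (\<lambda>_. True) Y B (f \<circ> id) (f \<circ> (\<lambda>_. a))"
    using a(2) f by (rule homotopic_with_compose_continuous_map_left) simp
  then have hom: "homotopic_with (\<lambda>_. True) Y B (\<lambda>_. f a) f"
    by (subst homotopic_with_sym) (simp add: o_def)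
  have "f a \<in> p ` topspace E"
    using p f a(1) by (auto simp: covering_map_def dest: continuous_map_funspace)
  then obtain e where "e \<in> topspace E" "p e = f a"
    by auto
  then have "is_lift E p Y (\<lambda>_. f a) (\<lambda>_. e)"
    by (simp add: is_lift_def)
  then have "liftable E p Y (\<lambda>_. f a)"
    unfolding liftable_def by blast
  then show ?thesis
    by (rule liftable_homotopic[OF p hom])
qed

lemma is_lift_Un:
  assumes U: "openin X U" "is_lift E p (subtopology X U) f s"
    and V: "openin X V" "is_lift E p (subtopology X V) f t"
    and agree: "\<And>x. x \<in> U \<inter> V \<Longrightarrow> s x = t x"
  shows "is_lift E p (subtopology X (U \<union> V)) f (\<lambda>x. if x \<in> U then s x else t x)"
proof -
  let ?T = "\<lambda>b. if b then U else V"
  have "continuous_map (subtopology X (U \<union> V)) E (\<lambda>x. if x \<in> U then s x else t x)"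
  proof (rule pasting_lemma[where I = UNIV and T = ?T and f = "\<lambda>b. if b then s else t"])
    show "openin (subtopology X (U \<union> V)) (?T b)" for b
      using U V by (simp add: openin_open_subtopology openin_Un)
    show "continuous_map (subtopology (subtopology X (U \<union> V)) (?T b)) E (if b then s else t)" for b
      using U V by (auto simp: subtopology_subtopology Int_absorb1 is_lift_def)
    show "\<exists>b. b \<in> UNIV \<and> x \<in> ?T b \<and> (if x \<in> U then s x else t x) = (if b then s else t) x"
      if "x \<in> topspace (subtopology X (U \<union> V))" for x
      using that by (intro exI[of _ "x \<in> U"]) auto
  qed (use agree in \<open>auto split: if_splits\<close>)
  then show ?thesis
    using U V by (auto simp: is_lift_def)
qed

section \<open>The antipodal covering of the projective plane\<close>

abbreviation S2 :: "(real^3) set" where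
  "S2 \<equiv> sphere 0 1"

abbreviation sphere_lift :: "'y topology \<Rightarrow> ('y \<Rightarrow> (real^3) set) \<Rightarrow> ('y \<Rightarrow> real^3) \<Rightarrow> bool" where
  "sphere_lift \<equiv> is_lift (top_of_set S2) antipodal_class"

abbreviation sphere_liftable :: "'y topology \<Rightarrow> ('y \<Rightarrow> (real^3) set) \<Rightarrow> bool" where
  "sphere_liftable \<equiv> liftable (top_of_set S2) antipodal_class"

lemma topspace_real_projective_plane: "topspace real_projective_plane = antipodal_class ` S2"
  using quotient_imp_surjective_map[OF quotient_map_antipodal_class] by simp

lemma continuous_map_antipodal_class:
  "continuous_map (top_of_set S2) real_projective_plane antipodal_class"
  using quotient_map_antipodal_class by (rule quotient_imp_continuous_map)

lemma antipodal_class_uminus [simp]: "antipodal_class (- x) = antipodal_class x"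
  by (simp add: antipodal_class_eq_iff)

lemma antipodal_class_in_image_iff:
  "antipodal_class x \<in> antipodal_class ` T \<longleftrightarrow> x \<in> T \<or> - x \<in> T"
  unfolding image_iff antipodal_class_eq_iff by (metis minus_minus)

lemma openin_sphere_vimage_uminus:
  fixes T :: "(real^3) set"
  assumes "openin (top_of_set S2) T"
  shows "openin (top_of_set S2) (S2 \<inter> uminus -` T)"
  by (rule continuous_openin_preimage[OF _ _ assms]) (auto intro: continuous_intros)

lemma open_map_antipodal_class:
  "open_map (top_of_set S2) real_projective_plane antipodal_class"
  unfolding open_map_def
proof (intro allI impI)
  fix T assume T: "openin (top_of_set S2) T"
  have "openin (top_of_set S2) (S2 \<inter> uminus -` T)"
    using T by (rule openin_sphere_vimage_uminus)
  moreover have "{x \<in> S2. antipodal_class x \<in> antipodal_class ` T} = T \<union> (S2 \<inter> uminus -` T)"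
    using openin_subset[OF T] by (auto simp: antipodal_class_in_image_iff)
  ultimately show "openin real_projective_plane (antipodal_class ` T)"
    using openin_subset[OF T] T by (auto simp: openin_real_projective_plane)
qed

lemma homeomorphic_map_antipodal_class:
  assumes T: "openin (top_of_set S2) T" and disj: "\<And>x. x \<in> T \<Longrightarrow> - x \<notin> T"
  shows "homeomorphic_map (top_of_set T) (subtopology real_projective_plane (antipodal_class ` T))
           antipodal_class"
    (is "homeomorphic_map _ ?P _")
proof (rule bijective_open_imp_homeomorphic_map)
  have top_T: "top_of_set T = subtopology (top_of_set S2) T"
    using openin_subset[OF T] by (simp add: subtopology_subtopology Int_absorb1)
  show "continuous_map (top_of_set T) ?P antipodal_class"
    unfolding top_T
    by (auto simp: continuous_map_in_subtopology
        intro: continuous_map_from_subtopology continuous_map_antipodal_class)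
  show "open_map (top_of_set T) ?P antipodal_class"
    unfolding top_T
    by (intro open_map_into_subtopology open_map_from_subtopology open_map_antipodal_class T) auto
  show "inj_on antipodal_class (topspace (top_of_set T))"
    using disj by (auto simp: inj_on_def antipodal_class_eq_iff)
  show "antipodal_class ` topspace (top_of_set T) = topspace ?P"
    using openin_subset[OF T] by (auto simp: topspace_real_projective_plane)
qed

lemma evenly_covered_antipodal_class:
  assumes T: "openin (top_of_set S2) T" and disj: "\<And>x. x \<in> T \<Longrightarrow> - x \<notin> T"
  shows "evenly_covered (top_of_set S2) real_projective_plane antipodal_class (antipodal_class ` T)"
proof -
  let ?T' = "S2 \<inter> uminus -` T"
  have T_S2: "T \<subseteq> S2"
    using openin_subset[OF T] by simp
  have T': "openin (top_of_set S2) ?T'"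
    using T by (rule openin_sphere_vimage_uminus)
  have "antipodal_class ` ?T' = antipodal_class ` T"
    using T_S2 by (auto simp: antipodal_class_in_image_iff intro!: image_eqI[of _ _ "- _"])
  then have "homeomorphic_map (top_of_set ?T')
      (subtopology real_projective_plane (antipodal_class ` T)) antipodal_class"
    using homeomorphic_map_antipodal_class[OF T'] disj by fastforce
  then have "\<forall>V\<in>{T, ?T'}. openin (top_of_set S2) V \<and> homeomorphic_map (subtopology (top_of_set S2) V)
      (subtopology real_projective_plane (antipodal_class ` T)) antipodal_class"
    using T T' T_S2 homeomorphic_map_antipodal_class[OF T disj]
    by (auto simp: subtopology_subtopology Int_absorb1)
  moreover have "\<Union>{T, ?T'} = {x \<in> topspace (top_of_set S2). antipodal_class x \<in> antipodal_class ` T}"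
    using T_S2 by (auto simp: antipodal_class_in_image_iff)
  moreover have "pairwise disjnt {T, ?T'}"
    using disj by (auto simp: pairwise_insert disjnt_iff)
  moreover have "openin real_projective_plane (antipodal_class ` T)"
    using open_map_antipodal_class T unfolding open_map_def by blast
  ultimately show ?thesis
    unfolding evenly_covered_def by blast
qed

lemma openin_hemisphere: "openin (top_of_set S2) {x \<in> S2. 0 < x \<bullet> v}"
proof -
  have "openin (top_of_set S2) (S2 \<inter> (\<lambda>x. x \<bullet> v) -` {0<..})"
    by (intro continuous_openin_preimage_gen continuous_intros open_greaterThan)
  moreover have "S2 \<inter> (\<lambda>x. x \<bullet> v) -` {0<..} = {x \<in> S2. 0 < x \<bullet> v}"
    by auto
  ultimately show ?thesis
    by simp
qed

lemma covering_map_antipodal_class: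
  "covering_map (top_of_set S2) real_projective_plane antipodal_class"
  unfolding covering_map_def
proof (intro conjI ballI continuous_map_antipodal_class)
  fix c assume "c \<in> topspace real_projective_plane"
  then obtain v where v: "v \<in> S2" "c = antipodal_class v"
    unfolding topspace_real_projective_plane by blast
  then have "c \<in> antipodal_class ` {x \<in> S2. 0 < x \<bullet> v}"
    by (auto simp: antipodal_class_in_image_iff)
  moreover have "evenly_covered (top_of_set S2) real_projective_plane antipodal_class
      (antipodal_class ` {x \<in> S2. 0 < x \<bullet> v})"
    by (rule evenly_covered_antipodal_class[OF openin_hemisphere]) auto
  ultimately show "\<exists>U. c \<in> U \<and> evenly_covered (top_of_set S2) real_projective_plane antipodal_class U"
    by (intro exI conjI)
qed (simp add: topspace_real_projective_plane)

lemma sphere_lift_uminus: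
  assumes "sphere_lift Y f s"
  shows "sphere_lift Y f (\<lambda>y. - s y)"
proof -
  have "continuous_map (top_of_set S2) (top_of_set S2) uminus"
    by (auto simp: continuous_map_in_subtopology intro: continuous_intros)
  then show ?thesis
    using assms continuous_map_compose[of Y "top_of_set S2" s "top_of_set S2" uminus]
    by (simp add: is_lift_def o_def)
qed

lemma sphere_lifts_agree_up_to_sign:
  assumes Y: "connected_space Y" and s: "sphere_lift Y f s" and t: "sphere_lift Y f t"
  shows "(\<forall>y\<in>topspace Y. s y = t y) \<or> (\<forall>y\<in>topspace Y. s y = - t y)"
proof (cases "topspace Y = {}")
  case False
  then obtain a where a: "a \<in> topspace Y"
    by blast
  then have "s a = t a \<or> s a = - t a"
    using s t by (auto simp: is_lift_def simp flip: antipodal_class_eq_iff)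
  then show ?thesis
    using lift_unique[OF covering_map_antipodal_class s t Y a]
      lift_unique[OF covering_map_antipodal_class s sphere_lift_uminus[OF t] Y a] by blast
qed simp

lemma sphere_liftable_Un:
  assumes U: "openin X U" "sphere_liftable (subtopology X U) f"
    and V: "openin X V" "sphere_liftable (subtopology X V) f"
    and UV: "connectedin X (U \<inter> V)"
  shows "sphere_liftable (subtopology X (U \<union> V)) f"
proof -
  obtain s where s: "sphere_lift (subtopology X U) f s"
    using U(2) unfolding liftable_def by blast
  obtain t where t: "sphere_lift (subtopology X V) f t"
    using V(2) unfolding liftable_def by blast
  have "sphere_lift (subtopology X (U \<inter> V)) f s" "sphere_lift (subtopology X (U \<inter> V)) f t"
    using is_lift_subtopology[OF s, of V] is_lift_subtopology[OF t, of U]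
    by (simp_all add: subtopology_subtopology Int_commute)
  then have "(\<forall>y\<in>U \<inter> V. s y = t y) \<or> (\<forall>y\<in>U \<inter> V. s y = - t y)"
    using sphere_lifts_agree_up_to_sign[of "subtopology X (U \<inter> V)" f s t] UV
    by (simp add: connectedin_def Int_absorb1)
  then obtain t' where "sphere_lift (subtopology X V) f t'" "\<And>y. y \<in> U \<inter> V \<Longrightarrow> s y = t' y"
    using t sphere_lift_uminus[OF t] by metis
  then show ?thesis
    using is_lift_Un[OF U(1) s V(1)] unfolding liftable_def by blast
qed

lemma sphere_liftable_Union:
  assumes "finite \<A>" and "\<And>U. U \<in> \<A> \<Longrightarrow> openin X U \<and> sphere_liftable (subtopology X U) f"
    and "\<And>U V. U \<in> \<A> \<Longrightarrow> V \<in> \<A> \<Longrightarrow> connectedin X (U \<inter> V)" and "x \<in> \<Inter>\<A>"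
  shows "sphere_liftable (subtopology X (\<Union>\<A>)) f"
  using assms
proof (induction \<A>)
  case empty
  then show ?case
    by (simp add: liftable_trivial_topology)
next
  case (insert U \<A>)
  have "connectedin X (\<Union>V\<in>\<A>. U \<inter> V)"
  proof (rule connectedin_Union)
    show "connectedin X T" if "T \<in> (\<inter>) U ` \<A>" for T
      using that insert.prems(2) by blast
    have "x \<in> \<Inter> ((\<inter>) U ` \<A>)"
      using insert.prems(3) by simp
    then show "\<Inter> ((\<inter>) U ` \<A>) \<noteq> {}"
      by blast
  qed
  then have "connectedin X (U \<inter> \<Union>\<A>)"
    by (simp only: Int_Union)
  moreover have "sphere_liftable (subtopology X (\<Union>\<A>)) f"
    by (rule insert.IH) (use insert.prems in auto)
  ultimately have "sphere_liftable (subtopology X (U \<union> \<Union>\<A>)) f"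
    using insert.prems by (intro sphere_liftable_Un) auto
  then show ?case
    by simp
qed

section \<open>Covers of the projective plane by liftable sets\<close>

lemma exp_eq_imp_dist_ge_1:
  fixes u v :: complex
  assumes "exp u = exp v" "u \<noteq> v"
  shows "1 \<le> dist u v"
proof -
  obtain n :: int where n: "u = v + (of_int (2 * n) * pi) * \<i>"
    using assms(1) unfolding exp_eq by blast
  then have "dist u v = \<bar>2 * real_of_int n\<bar> * pi"
    by (simp add: dist_norm norm_mult)
  moreover have "1 \<le> \<bar>real_of_int n\<bar>"
    using assms(2) n by (cases "n = 0") auto
  ultimately show ?thesis
    using mult_mono[of 1 "\<bar>2 * real_of_int n\<bar>" 1 pi] pi_ge_two by simp
qed

theorem no_odd_nonvanishing_map:
  fixes S :: "'a::real_normed_vector set" and f :: "'a \<Rightarrow> complex"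
  assumes S: "simply_connected S" "locally path_connected S" "S \<noteq> {}" "\<And>x. x \<in> S \<Longrightarrow> - x \<in> S"
    and f: "continuous_on S f" "\<And>x. x \<in> S \<Longrightarrow> f (- x) = - f x" "\<And>x. x \<in> S \<Longrightarrow> f x \<noteq> 0"
  shows False
proof -
  obtain g where g: "continuous_on S g" "\<And>x. x \<in> S \<Longrightarrow> f x = exp (g x)"
    using continuous_logarithm_on_simply_connected[OF f(1) S(1,2) f(3)] by blast
  define d where "d x = g (- x) - g x" for x
  have exp_d: "exp (d x) = - 1" if "x \<in> S" for x
    using f(2,3)[OF that] g(2)[OF that] g(2)[OF S(4)[OF that]] by (simp add: d_def exp_diff)
  have "continuous_on S (\<lambda>x. g (- x))"
    using S(4) by (intro continuous_on_compose2[OF g(1)] continuous_intros) auto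
  then have "continuous_on S d"
    unfolding d_def using g(1) by (intro continuous_intros)
  moreover have "\<exists>e>0. \<forall>y. y \<in> S \<and> d y \<noteq> d x \<longrightarrow> e \<le> norm (d y - d x)" if "x \<in> S" for x
    using exp_eq_imp_dist_ge_1 exp_d that by (intro exI[of _ 1]) (auto simp: dist_norm)
  ultimately have "d constant_on S"
    using S(1) by (intro continuous_discrete_range_constant simply_connected_imp_connected)
  moreover obtain a where a: "a \<in> S"
    using S(3) by blast
  ultimately have "d (- a) = d a"
    using S(4) unfolding constant_on_def by metis
  then have "d a = 0"
    by (simp add: d_def)
  then show False
    using exp_d[OF a] by simp
qed

lemma odd_function_with_support:
  fixes S P :: "'a::real_normed_vector set"
  assumes S: "\<And>x. x \<in> S \<Longrightarrow> - x \<in> S"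
    and P: "openin (top_of_set S) P" "\<And>x. x \<in> P \<Longrightarrow> - x \<notin> P"
  obtains \<psi> :: "'a \<Rightarrow> real" where "continuous_on S \<psi>" "\<And>x. \<psi> (- x) = - \<psi> x"
    "\<And>x. x \<in> S \<Longrightarrow> \<psi> x \<noteq> 0 \<longleftrightarrow> x \<in> P \<or> - x \<in> P"
proof
  define \<psi> where "\<psi> x = infdist x (S - P) - infdist (- x) (S - P)" for x
  have PS: "P \<subseteq> S"
    using openin_subset[OF P(1)] by simp
  have infdist_eq_0: "infdist x (S - P) = 0 \<longleftrightarrow> x \<notin> P" if x: "x \<in> S" for x
  proof
    assume "infdist x (S - P) = 0"
    show "x \<notin> P"
    proof
      assume "x \<in> P"
      then have "S - P \<noteq> {}"
        using S[of x] P(2)[of x] PS by blast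
      then have "x \<in> closure (S - P)"
        using \<open>infdist x (S - P) = 0\<close> by (simp add: in_closure_iff_infdist_zero)
      moreover obtain T where "open T" "P = S \<inter> T"
        using P(1) by (auto simp: openin_open)
      moreover from this have "closure (S - P) \<subseteq> - T"
        by (intro closure_minimal) auto
      ultimately show False
        using \<open>x \<in> P\<close> by blast
    qed
  qed (use x in simp)
  show "continuous_on S \<psi>"
    unfolding \<psi>_def by (intro continuous_intros)
  show "\<psi> (- x) = - \<psi> x" for x
    by (simp add: \<psi>_def)
  show "\<psi> x \<noteq> 0 \<longleftrightarrow> x \<in> P \<or> - x \<in> P" if x: "x \<in> S" for x
    using infdist_eq_0[OF x] infdist_eq_0[OF S[OF x]] P(2)[of x]
    by (cases "x \<in> P"; cases "- x \<in> P") (auto simp: \<psi>_def)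
qed

lemma sphere_lift_id_cases:
  assumes A: "openin real_projective_plane A"
    and s: "sphere_lift (subtopology real_projective_plane A) id s"
    and x: "antipodal_class x \<in> A"
  shows "s (antipodal_class x) = x \<or> s (antipodal_class x) = - x"
proof -
  have "antipodal_class (s (antipodal_class x)) = antipodal_class x"
    using s x openin_subset[OF A] by (auto simp: is_lift_def)
  then show ?thesis
    by (simp add: antipodal_class_eq_iff)
qed

lemma openin_image_sphere_lift:
  assumes A: "openin real_projective_plane A"
    and s: "sphere_lift (subtopology real_projective_plane A) id s"
  shows "openin (top_of_set S2) {x \<in> S2. antipodal_class x \<in> A \<and> s (antipodal_class x) = x}"
proof -
  define D where "D = {x \<in> S2. antipodal_class x \<in> A}"
  have D: "openin (top_of_set S2) D"
    using A unfolding openin_real_projective_plane D_def by simp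
  have "continuous_map (top_of_set D) (subtopology real_projective_plane A) antipodal_class"
    using continuous_map_from_subtopology_mono[OF continuous_map_antipodal_class, of D]
      openin_subset[OF D]
    by (auto simp: continuous_map_in_subtopology D_def)
  from is_lift_compose[OF s this]
  have "continuous_on D (\<lambda>x. s (antipodal_class x))"
    by (simp add: is_lift_def continuous_map_in_subtopology)
  then have "openin (top_of_set D) (D \<inter> (\<lambda>x. s (antipodal_class x) \<bullet> x) -` {0<..})"
    by (intro continuous_openin_preimage_gen continuous_intros open_greaterThan)
  moreover have "0 < s (antipodal_class x) \<bullet> x \<longleftrightarrow> s (antipodal_class x) = x" if x: "x \<in> D" for x
  proof -
    have "s (antipodal_class x) = x \<or> s (antipodal_class x) = - x"
      using x by (intro sphere_lift_id_cases[OF A s]) (simp add: D_def)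
    moreover have "0 < x \<bullet> x"
      using x by (auto simp: D_def)
    ultimately show ?thesis
      by (metis inner_minus_left neg_0_less_iff_less order_less_asym)
  qed
  then have "D \<inter> (\<lambda>x. s (antipodal_class x) \<bullet> x) -` {0<..}
      = {x \<in> S2. antipodal_class x \<in> A \<and> s (antipodal_class x) = x}"
    by (auto simp: D_def)
  ultimately show ?thesis
    using openin_trans[OF _ D] by simp
qed

lemma odd_function_of_sphere_liftable:
  assumes A: "openin real_projective_plane A"
    and lift: "sphere_liftable (subtopology real_projective_plane A) id"
  obtains \<psi> :: "real^3 \<Rightarrow> real" where "continuous_on S2 \<psi>" "\<And>x. \<psi> (- x) = - \<psi> x"
    "\<And>x. x \<in> S2 \<Longrightarrow> \<psi> x \<noteq> 0 \<longleftrightarrow> antipodal_class x \<in> A"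
proof -
  obtain s where s: "sphere_lift (subtopology real_projective_plane A) id s"
    using lift unfolding liftable_def by blast
  define P where "P = {x \<in> S2. antipodal_class x \<in> A \<and> s (antipodal_class x) = x}"
  have "- x \<notin> P" if "x \<in> P" for x
  proof
    assume "- x \<in> P"
    then have "s (antipodal_class x) = - x" "s (antipodal_class x) = x"
      using that by (simp_all add: P_def)
    then have "x \<bullet> x = - x \<bullet> x"
      by metis
    moreover have "0 < x \<bullet> x"
      using that by (auto simp: P_def)
    ultimately show False
      by simp
  qed
  then obtain \<psi> :: "real^3 \<Rightarrow> real" where \<psi>: "continuous_on S2 \<psi>" "\<And>x. \<psi> (- x) = - \<psi> x"
    "\<And>x. x \<in> S2 \<Longrightarrow> \<psi> x \<noteq> 0 \<longleftrightarrow> x \<in> P \<or> - x \<in> P"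
    using openin_image_sphere_lift[OF A s, folded P_def] odd_function_with_support[of S2 P] by auto
  have "x \<in> P \<or> - x \<in> P \<longleftrightarrow> antipodal_class x \<in> A" if "x \<in> S2" for x
    using that sphere_lift_id_cases[OF A s, of x] by (auto simp: P_def)
  then show ?thesis
    using that[OF \<psi>(1,2)] \<psi>(3) by blast
qed

text \<open>The coefficients \<open>Complex 1 (k i)\<close> are pairwise linearly independent over the reals.\<close>

lemma sum_mult_Complex_neq_0:
  fixes c k :: "'i \<Rightarrow> real"
  assumes I: "finite I" and k: "inj_on k I"
    and supp: "{i \<in> I. c i \<noteq> 0} \<noteq> {}" "card {i \<in> I. c i \<noteq> 0} \<le> 2"
  shows "(\<Sum>i\<in>I. of_real (c i) * Complex 1 (k i)) \<noteq> 0"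
proof
  assume "(\<Sum>i\<in>I. of_real (c i) * Complex 1 (k i)) = 0"
  then have Re: "(\<Sum>i\<in>I. c i) = 0" and Im: "(\<Sum>i\<in>I. c i * k i) = 0"
    by (simp_all add: complex_eq_iff)
  have sum_supp: "(\<Sum>i\<in>I. c i * h i) = (\<Sum>i | i \<in> I \<and> c i \<noteq> 0. c i * h i)" for h
    using I by (intro sum.mono_neutral_right) auto
  have "card {i \<in> I. c i \<noteq> 0} \<noteq> 0"
    using I supp(1) by simp
  then consider "card {i \<in> I. c i \<noteq> 0} = 1" | "card {i \<in> I. c i \<noteq> 0} = 2"
    using supp(2) by linarith
  then show False
  proof cases
    case 1
    then obtain i where i: "{i \<in> I. c i \<noteq> 0} = {i}"
      by (auto simp: card_1_singleton_iff)
    then have "c i = 0"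
      using sum_supp[of "\<lambda>_. 1"] Re by simp
    then show False
      using i by blast
  next
    case 2
    then obtain i j where ij: "{i \<in> I. c i \<noteq> 0} = {i, j}" "i \<noteq> j"
      by (auto simp: card_2_iff)
    have "c i * (k i - k j) = (\<Sum>l\<in>{i, j}. c l * (k l - k j))"
      using ij(2) by simp
    also have "\<dots> = (\<Sum>l\<in>I. c l * (k l - k j))"
      unfolding sum_supp ij(1) ..
    also have "\<dots> = (\<Sum>l\<in>I. c l * k l) - (\<Sum>l\<in>I. c l) * k j"
      by (simp add: right_diff_distrib sum_subtractf sum_distrib_right)
    also have "\<dots> = 0"
      using Re Im by simp
    finally show False
      using ij k by (auto dest: inj_onD)
  qed
qed

lemma sphere_liftable_cover_triple_point:
  assumes I: "finite I" and cover: "topspace real_projective_plane \<subseteq> (\<Union>i\<in>I. A i)"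
    and A: "\<And>i. i \<in> I \<Longrightarrow> openin real_projective_plane (A i)"
      "\<And>i. i \<in> I \<Longrightarrow> sphere_liftable (subtopology real_projective_plane (A i)) id"
  shows "\<exists>c\<in>topspace real_projective_plane. 3 \<le> card {i \<in> I. c \<in> A i}"
proof (rule ccontr)
  assume no_triple_point: "\<not> ?thesis"
  have "\<exists>\<psi> :: real^3 \<Rightarrow> real. continuous_on S2 \<psi> \<and> (\<forall>x. \<psi> (- x) = - \<psi> x) \<and>
      (\<forall>x\<in>S2. \<psi> x \<noteq> 0 \<longleftrightarrow> antipodal_class x \<in> A i)" if "i \<in> I" for i
    using odd_function_of_sphere_liftable[OF A[OF that]] by metis
  then obtain \<psi> :: "_ \<Rightarrow> real^3 \<Rightarrow> real" where \<psi>: "\<And>i. i \<in> I \<Longrightarrow> continuous_on S2 (\<psi> i)"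
    "\<And>i x. i \<in> I \<Longrightarrow> \<psi> i (- x) = - \<psi> i x"
    "\<And>i x. i \<in> I \<Longrightarrow> x \<in> S2 \<Longrightarrow> \<psi> i x \<noteq> 0 \<longleftrightarrow> antipodal_class x \<in> A i"
    by metis
  obtain k :: "_ \<Rightarrow> nat" where k: "inj_on k I"
    using finite_imp_inj_to_nat_seg[OF I] by blast
  show False
  proof (rule no_odd_nonvanishing_map)
    show "continuous_on S2 (\<lambda>x. \<Sum>i\<in>I. of_real (\<psi> i x) * Complex 1 (real (k i)))"
      using \<psi>(1) by (intro continuous_intros) auto
    show "(\<Sum>i\<in>I. of_real (\<psi> i (- x)) * Complex 1 (real (k i)))
        = - (\<Sum>i\<in>I. of_real (\<psi> i x) * Complex 1 (real (k i)))" for x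
      using \<psi>(2) by (simp flip: sum_negf)
    show "(\<Sum>i\<in>I. of_real (\<psi> i x) * Complex 1 (real (k i))) \<noteq> 0" if x: "x \<in> S2" for x
    proof (rule sum_mult_Complex_neq_0[OF I])
      show "inj_on (\<lambda>i. real (k i)) I"
        using k by (simp add: inj_on_def)
      have c: "antipodal_class x \<in> topspace real_projective_plane"
        using x unfolding topspace_real_projective_plane by blast
      have supp: "{i \<in> I. \<psi> i x \<noteq> 0} = {i \<in> I. antipodal_class x \<in> A i}"
        using \<psi>(3) x by blast
      show "{i \<in> I. \<psi> i x \<noteq> 0} \<noteq> {}"
        unfolding supp using c cover by blast
      show "card {i \<in> I. \<psi> i x \<noteq> 0} \<le> 2"
        unfolding supp using c no_triple_point by fastforce
    qed
  qed (simp_all add: simply_connected_sphere locally_path_connected_sphere)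
qed

lemma dominating_sphere_liftable_cover_triple_point:
  assumes f: "continuous_map X real_projective_plane f"
    and g: "continuous_map real_projective_plane X g"
    and fg: "homotopic_with (\<lambda>_. True) real_projective_plane real_projective_plane (f \<circ> g) id"
    and \<V>: "finite \<V>" "topspace X \<subseteq> \<Union>\<V>"
      "\<And>V. V \<in> \<V> \<Longrightarrow> openin X V \<and> sphere_liftable (subtopology X V) f"
  shows "\<exists>x\<in>topspace X. 3 \<le> card {V \<in> \<V>. x \<in> V}"
proof -
  let ?R = real_projective_plane
  define A where "A V = {c \<in> topspace ?R. g c \<in> V}" for V
  have A: "openin ?R (A V)" "sphere_liftable (subtopology ?R (A V)) id" if V: "V \<in> \<V>" for V
  proof -
    show "openin ?R (A V)"
      unfolding A_def using \<V>(3)[OF V] openin_continuous_map_preimage[OF g] by blast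
    have "continuous_map (subtopology ?R (A V)) (subtopology X V) g"
      using continuous_map_from_subtopology[OF g]
      by (auto simp: continuous_map_in_subtopology A_def)
    then have "sphere_liftable (subtopology ?R (A V)) (f \<circ> g)"
      using \<V>(3)[OF V] by (auto simp: o_def intro: liftable_compose)
    moreover have "homotopic_with (\<lambda>_. True) (subtopology ?R (A V)) ?R (f \<circ> g) id"
      by (rule homotopic_from_subtopology[OF fg])
    ultimately show "sphere_liftable (subtopology ?R (A V)) id"
      using liftable_homotopic[OF covering_map_antipodal_class] by blast
  qed
  have "g c \<in> topspace X" if "c \<in> topspace ?R" for c
    using continuous_map_funspace[OF g] that by blast
  then have "topspace ?R \<subseteq> (\<Union>V\<in>\<V>. A V)"
    using \<V>(2) by (auto simp: A_def)
  from sphere_liftable_cover_triple_point[OF \<V>(1) this A]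
  obtain c where c: "c \<in> topspace ?R" "3 \<le> card {V \<in> \<V>. c \<in> A V}"
    by blast
  then show ?thesis
    using continuous_map_funspace[OF g] by (intro bexI[of _ "g c"]) (auto simp: A_def)
qed

lemma subset_pair_of_card_le_2:
  assumes "finite A" "card A \<le> 2" "A \<subseteq> B" "B \<noteq> {}"
  obtains x y where "x \<in> B" "y \<in> B" "A \<subseteq> {x, y}"
proof -
  consider "card A = 0" | "card A = 1" | "card A = 2"
    using assms(2) by linarith
  then show ?thesis
    using that assms by cases (auto simp: card_1_singleton_iff card_2_iff)
qed

lemma connectedin_good_cover_Int:
  assumes \<U>: "good_cover X \<U>" and UV: "U \<in> \<U>" "V \<in> \<U>"
  shows "connectedin X (U \<inter> V)"
proof (cases "U \<inter> V = {}")
  case False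
  then have "contractible_space (subtopology X (\<Inter>{U, V}))"
    using \<U>[unfolded good_cover_def] UV by (metis finite.emptyI finite.insertI empty_subsetI
        Inter_insert Inf_empty inf_top.right_neutral insert_not_empty insert_subset)
  moreover have "U \<inter> V \<subseteq> topspace X"
    using \<U> UV openin_subset[of X U] by (auto simp: good_cover_def)
  ultimately show ?thesis
    by (simp add: connectedin_def contractible_imp_connected_space)
qed simp

theorem good_cover_dominating_card_ge_6:
  assumes f: "continuous_map X real_projective_plane f"
    and g: "continuous_map real_projective_plane X g"
    and fg: "homotopic_with (\<lambda>_. True) real_projective_plane real_projective_plane (f \<circ> g) id"
    and \<U>: "finite \<U>" "good_cover X \<U>"
  shows "6 \<le> card \<U>"
proof (rule ccontr)
  assume card: "\<not> 6 \<le> card \<U>"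
  have liftable: "openin X U \<and> sphere_liftable (subtopology X U) f" if "U \<in> \<U>" for U
    using \<U>(2) that f unfolding good_cover_def
    by (auto intro: liftable_contractible_space[OF covering_map_antipodal_class]
        continuous_map_from_subtopology)
  have cover: "\<Union>\<U> = topspace X"
    using \<U>(2) by (simp add: good_cover_def)
  note triple_point = dominating_sphere_liftable_cover_triple_point[OF f g fg]
  note conn = connectedin_good_cover_Int[OF \<U>(2)]
  obtain x where x: "x \<in> topspace X" "3 \<le> card {U \<in> \<U>. x \<in> U}"
    using triple_point[OF \<U>(1) _ liftable] cover by blast
  define A where "A = \<Union>{U \<in> \<U>. x \<in> U}"
  have "openin X A \<and> sphere_liftable (subtopology X A) f"
    unfolding A_def using \<U>(1) liftable conn by (auto intro!: sphere_liftable_Union)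
  moreover have "card (\<U> - {U \<in> \<U>. x \<in> U}) \<le> 2"
    using x(2) card \<U>(1) by (subst card_Diff_subset) auto
  moreover have "\<U> \<noteq> {}"
    using x(1) cover by blast
  ultimately obtain V W where VW: "V \<in> \<U>" "W \<in> \<U>" "\<U> - {U \<in> \<U>. x \<in> U} \<subseteq> {V, W}"
    using subset_pair_of_card_le_2[of "\<U> - {U \<in> \<U>. x \<in> U}" \<U>] \<U>(1) by blast
  have "openin X (V \<union> W) \<and> sphere_liftable (subtopology X (V \<union> W)) f"
    using liftable conn VW by (auto intro: sphere_liftable_Un)
  moreover have "topspace X \<subseteq> \<Union>{A, V \<union> W}"
    using VW(3) unfolding cover[symmetric] A_def by auto
  ultimately obtain y where "3 \<le> card {T \<in> {A, V \<union> W}. y \<in> T}"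
    using triple_point[of "{A, V \<union> W}"] \<open>openin X A \<and> sphere_liftable (subtopology X A) f\<close> by blast
  also have "\<dots> \<le> card {A, V \<union> W}"
    by (intro card_mono) auto
  also have "\<dots> \<le> 2"
    by (simp add: card_insert_le_m1)
  finally show False
    by simp
qed

section \<open>Good covers by circular caps\<close>

lemma contractible_sphere_Int_convex:
  fixes K :: "'a::real_normed_vector set"
  assumes K: "convex K" "0 \<notin> K" "\<And>c x. x \<in> K \<Longrightarrow> 1 \<le> c \<Longrightarrow> c *\<^sub>R x \<in> K"
  shows "contractible (sphere 0 1 \<inter> K)"
proof (rule retract_of_contractible)
  show "contractible (cball 0 1 \<inter> K)"
    using K(1) by (intro convex_imp_contractible convex_Int convex_cball)
  have "sgn x \<in> sphere 0 1 \<inter> K" if x: "x \<in> cball 0 1 \<inter> K" for x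
  proof -
    have "x \<noteq> 0"
      using x K(2) by auto
    then have "sgn x \<in> K"
      using x K(3)[of x "inverse (norm x)"] by (simp add: sgn_div_norm one_le_inverse)
    then show ?thesis
      using \<open>x \<noteq> 0\<close> by (simp add: norm_sgn)
  qed
  moreover have "continuous_on (cball 0 1 \<inter> K) sgn"
    using K(2) by (intro continuous_intros) auto
  ultimately have "retraction (cball 0 1 \<inter> K) (sphere 0 1 \<inter> K) sgn"
    by (auto simp: retraction_def sgn_div_norm)
  then show "sphere 0 1 \<inter> K retract_of cball 0 1 \<inter> K"
    unfolding retract_of_def by blast
qed

definition projective_cap :: "real \<Rightarrow> real^3 \<Rightarrow> (real^3) set set" where
  "projective_cap r v = antipodal_class ` {x \<in> S2. r < \<bar>x \<bullet> v\<bar>}"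

lemma antipodal_class_in_projective_cap:
  "x \<in> S2 \<Longrightarrow> antipodal_class x \<in> projective_cap r v \<longleftrightarrow> r < \<bar>x \<bullet> v\<bar>"
  by (simp add: projective_cap_def antipodal_class_in_image_iff)

lemma openin_projective_cap: "openin real_projective_plane (projective_cap r v)"
proof -
  have "openin (top_of_set S2) (S2 \<inter> (\<lambda>x. \<bar>x \<bullet> v\<bar>) -` {r<..})"
    by (intro continuous_openin_preimage_gen continuous_intros open_greaterThan)
  moreover have "S2 \<inter> (\<lambda>x. \<bar>x \<bullet> v\<bar>) -` {r<..} = {x \<in> S2. r < \<bar>x \<bullet> v\<bar>}"
    by auto
  ultimately show ?thesis
    using open_map_antipodal_class by (simp add: open_map_def projective_cap_def)
qed

lemma contractible_space_antipodal_class_halfspaces: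
  assumes W: "finite W" "W \<noteq> {}" and r: "0 \<le> r"
  shows "contractible_space (subtopology real_projective_plane
           (antipodal_class ` {x \<in> S2. \<forall>w\<in>W. r < x \<bullet> w}))"
proof -
  define K where "K = (\<Inter>w\<in>W. {x. r < w \<bullet> x})"
  obtain w where w: "w \<in> W"
    using W(2) by blast
  have "contractible (S2 \<inter> K)"
  proof (rule contractible_sphere_Int_convex)
    show "convex K"
      unfolding K_def by (intro convex_INT convex_halfspace_gt)
    show "0 \<notin> K"
      using w r by (auto simp: K_def)
    show "c *\<^sub>R x \<in> K" if "x \<in> K" "1 \<le> c" for c x
      unfolding K_def
    proof (intro INT_I CollectI)
      fix w assume "w \<in> W"
      then have "r < w \<bullet> x"
        using that(1) by (simp add: K_def)
      also have "\<dots> \<le> c * (w \<bullet> x)"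
        using \<open>r < w \<bullet> x\<close> r that(2) by (simp add: mult_left_le_one_le mult_le_cancel_right1)
      finally show "r < w \<bullet> c *\<^sub>R x"
        by simp
    qed
  qed
  moreover have "openin (top_of_set S2) (S2 \<inter> K)"
    unfolding K_def using W(1) by (intro openin_open_Int open_INT ballI open_halfspace_gt)
  then have "homeomorphic_map (top_of_set (S2 \<inter> K))
      (subtopology real_projective_plane (antipodal_class ` (S2 \<inter> K))) antipodal_class"
    using w r by (intro homeomorphic_map_antipodal_class) (force simp: K_def)+
  then have "top_of_set (S2 \<inter> K) homeomorphic_space
      subtopology real_projective_plane (antipodal_class ` (S2 \<inter> K))"
    by (rule homeomorphic_map_imp_homeomorphic_space)
  moreover have "S2 \<inter> K = {x \<in> S2. \<forall>w\<in>W. r < x \<bullet> w}"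
    by (auto simp: K_def inner_commute)
  ultimately show ?thesis
    by (simp flip: homeomorphic_space_contractibility)
qed

lemma inner_gt_if_close_to_common_unit_vector:
  fixes x a b :: "'a::real_inner"
  assumes x: "norm x = 1" and r: "0 \<le> r" "r < x \<bullet> a" "r < x \<bullet> b" and n: "a \<bullet> a = n" "b \<bullet> b = n"
  shows "2 * r\<^sup>2 - n < a \<bullet> b"
proof -
  have "2 * r < x \<bullet> (a + b)"
    using r by (simp add: inner_add_right)
  also have "\<dots> \<le> norm (a + b)"
    using norm_cauchy_schwarz[of x "a + b"] x by simp
  finally have "(2 * r)\<^sup>2 < (norm (a + b))\<^sup>2"
    using r(1) by (intro power_strict_mono) auto
  also have "\<dots> = 2 * n + 2 * (a \<bullet> b)"
    using n by (simp add: power2_norm_eq_inner inner_add_left inner_add_right inner_commute)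
  finally show ?thesis
    by (simp add: power2_eq_square)
qed

lemma on_same_or_opposite_side:
  fixes a x :: "'a::real_inner"
  assumes ax: "norm a = 1" "norm x = 1" and r: "0 \<le> r"
    and W: "\<And>w. w \<in> W \<Longrightarrow> r < a \<bullet> w" "\<And>w. w \<in> W \<Longrightarrow> r < \<bar>x \<bullet> w\<bar>" "\<And>w. w \<in> W \<Longrightarrow> w \<bullet> w = n"
    and sep: "\<And>v w. v \<in> W \<Longrightarrow> w \<in> W \<Longrightarrow> n - 2 * r\<^sup>2 \<le> \<bar>v \<bullet> w\<bar>"
  shows "(\<forall>w\<in>W. r < x \<bullet> w) \<or> (\<forall>w\<in>W. r < - x \<bullet> w)"
proof (rule ccontr)
  assume "\<not> ?thesis"
  then obtain v w where vw: "v \<in> W" "\<not> r < - x \<bullet> v" "w \<in> W" "\<not> r < x \<bullet> w"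
    by blast
  then have "r < x \<bullet> v" "r < x \<bullet> - w"
    using W(2)[of v] W(2)[of w] by auto
  then have "2 * r\<^sup>2 - n < v \<bullet> - w"
    using ax(2) r W(3)[OF vw(1)] W(3)[OF vw(3)]
    by (intro inner_gt_if_close_to_common_unit_vector[of x]) auto
  moreover have "2 * r\<^sup>2 - n < v \<bullet> w"
    using ax(1) r W(1,3) vw by (intro inner_gt_if_close_to_common_unit_vector[of a]) auto
  ultimately show False
    using sep[OF vw(1,3)] by simp
qed

lemma Inter_projective_caps:
  assumes "J \<noteq> {}"
  shows "(\<Inter>v\<in>J. projective_cap r v) = antipodal_class ` {x \<in> S2. \<forall>v\<in>J. r < \<bar>x \<bullet> v\<bar>}"
proof (intro equalityI subsetI)
  fix c assume c: "c \<in> (\<Inter>v\<in>J. projective_cap r v)"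
  then obtain x where "x \<in> S2" "c = antipodal_class x"
    using assms unfolding projective_cap_def by blast
  then show "c \<in> antipodal_class ` {x \<in> S2. \<forall>v\<in>J. r < \<bar>x \<bullet> v\<bar>}"
    using c by (simp add: antipodal_class_in_projective_cap antipodal_class_in_image_iff)
qed (auto simp: antipodal_class_in_projective_cap)

lemma Inter_projective_caps_halfspaces:
  assumes r: "0 \<le> r" and J: "finite J" "J \<noteq> {}" and n: "\<And>v. v \<in> J \<Longrightarrow> v \<bullet> v = n"
    and sep: "\<And>v w. v \<in> J \<Longrightarrow> w \<in> J \<Longrightarrow> n - 2 * r\<^sup>2 \<le> \<bar>v \<bullet> w\<bar>"
    and ne: "(\<Inter>v\<in>J. projective_cap r v) \<noteq> {}"
  obtains W where "finite W" "W \<noteq> {}"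
    "(\<Inter>v\<in>J. projective_cap r v) = antipodal_class ` {x \<in> S2. \<forall>w\<in>W. r < x \<bullet> w}"
proof -
  obtain a where a: "a \<in> S2" "\<And>v. v \<in> J \<Longrightarrow> r < \<bar>a \<bullet> v\<bar>"
    using ne unfolding Inter_projective_caps[OF J(2)] by auto
  define W where "W = {w \<in> J \<union> uminus ` J. r < a \<bullet> w}"
  have a_W: "r < a \<bullet> w" if "w \<in> W" for w
    using that by (simp add: W_def)
  have J_W: "v \<in> W \<or> - v \<in> W" if "v \<in> J" for v
    using a(2)[OF that] that by (auto simp: W_def)
  have W_J: "w \<in> J \<or> - w \<in> J" if "w \<in> W" for w
    using that by (auto simp: W_def)
  have n_W: "w \<bullet> w = n" if "w \<in> W" for w
    using W_J[OF that] n[of w] n[of "- w"] by auto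
  have sep_W: "n - 2 * r\<^sup>2 \<le> \<bar>v \<bullet> w\<bar>" if "v \<in> W" "w \<in> W" for v w
    using W_J[OF that(1)] W_J[OF that(2)] sep[of v w] sep[of "- v" w] sep[of v "- w"]
      sep[of "- v" "- w"] by auto
  have abs_W: "(\<forall>v\<in>J. r < \<bar>x \<bullet> v\<bar>) \<longleftrightarrow> (\<forall>w\<in>W. r < \<bar>x \<bullet> w\<bar>)" for x
    using J_W W_J by (metis abs_minus_cancel inner_minus_right)
  have one_side: "(\<forall>w\<in>W. r < x \<bullet> w) \<or> (\<forall>w\<in>W. r < - x \<bullet> w)"
    if x: "x \<in> S2" "\<forall>w\<in>W. r < \<bar>x \<bullet> w\<bar>" for x
    using a(1) x r a_W n_W sep_W by (intro on_same_or_opposite_side[of a]) auto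
  have "(\<Inter>v\<in>J. projective_cap r v) = antipodal_class ` {x \<in> S2. \<forall>w\<in>W. r < x \<bullet> w}"
    unfolding Inter_projective_caps[OF J(2)] abs_W
  proof (intro equalityI subsetI)
    fix c assume "c \<in> antipodal_class ` {x \<in> S2. \<forall>w\<in>W. r < \<bar>x \<bullet> w\<bar>}"
    then show "c \<in> antipodal_class ` {x \<in> S2. \<forall>w\<in>W. r < x \<bullet> w}"
      using one_side by (auto simp: antipodal_class_in_image_iff)
  qed force
  moreover have "finite W"
    using J(1) by (simp add: W_def)
  moreover have "W \<noteq> {}"
    using J(2) J_W by blast
  ultimately show ?thesis
    using that by blast
qed

theorem good_cover_projective_caps:
  assumes J: "finite J" and r: "0 \<le> r" "r\<^sup>2 < n" and n: "\<And>v. v \<in> J \<Longrightarrow> v \<bullet> v = n"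
    and sep: "\<And>v w. v \<in> J \<Longrightarrow> w \<in> J \<Longrightarrow> n - 2 * r\<^sup>2 \<le> \<bar>v \<bullet> w\<bar>"
    and cover: "\<And>x. x \<in> S2 \<Longrightarrow> \<exists>v\<in>J. r < \<bar>x \<bullet> v\<bar>"
  shows "good_cover real_projective_plane (projective_cap r ` J)"
proof -
  have nonempty: "projective_cap r v \<noteq> {}" if "v \<in> J" for v
  proof -
    have norm_v: "(norm v)\<^sup>2 = n"
      using n[OF that] by (simp add: power2_norm_eq_inner)
    then have "r < norm v"
      using r(2) by (intro power2_less_imp_less[of r "norm v"]) auto
    moreover from this have "v \<noteq> 0"
      using r(1) by auto
    then have "sgn v \<in> S2" "sgn v \<bullet> v = norm v"
      by (simp_all add: norm_sgn sgn_div_norm dot_square_norm power2_eq_square)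
    ultimately show ?thesis
      using antipodal_class_in_projective_cap[of "sgn v" r v] by auto
  qed
  have contractible: "contractible_space (subtopology real_projective_plane (\<Inter>v\<in>I. projective_cap r v))"
    if I: "I \<subseteq> J" "I \<noteq> {}" and ne: "(\<Inter>v\<in>I. projective_cap r v) \<noteq> {}" for I
  proof -
    obtain W where W: "finite W" "W \<noteq> {}"
      and caps_eq: "(\<Inter>v\<in>I. projective_cap r v) = antipodal_class ` {x \<in> S2. \<forall>w\<in>W. r < x \<bullet> w}"
      by (rule Inter_projective_caps_halfspaces[OF r(1) finite_subset[OF I(1) J] I(2) n sep ne])
        (use I(1) in auto)
    show ?thesis
      unfolding caps_eq by (rule contractible_space_antipodal_class_halfspaces[OF W r(1)])
  qed
  have "\<Union>(projective_cap r ` J) = topspace real_projective_plane"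
    using cover openin_subset[OF openin_projective_cap]
    by (fastforce simp: topspace_real_projective_plane antipodal_class_in_projective_cap)
  moreover have "contractible_space (subtopology real_projective_plane (\<Inter>\<F>))"
    if "\<F> \<subseteq> projective_cap r ` J" "\<F> \<noteq> {}" "\<Inter>\<F> \<noteq> {}" for \<F>
    using that contractible by (auto simp: subset_image_iff)
  moreover have "contractible_space (subtopology real_projective_plane (projective_cap r v))"
    if "v \<in> J" for v
    using contractible[of "{v}"] nonempty[OF that] that by simp
  ultimately show ?thesis
    unfolding good_cover_def using nonempty by (auto simp: openin_projective_cap)
qed

text \<open>
  Rational approximations to one vertex from each antipodal pair of a regular icosahedron; the
  coordinate \<open>2\<close> stands for the golden ratio.  Caps with parameter \<open>r\<close> around these axes cover the
  plane if \<open>r\<^sup>2 < 10/6\<close> (average \<open>(x \<bullet> v)\<^sup>2\<close> over the axes \<open>v\<close>) and have convex intersections if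
  \<open>5 - 2 * r\<^sup>2 \<le> 2\<close>, hence the choice \<open>r = 5/4\<close> below.
\<close>

definition icosahedral_axes :: "(real^3) set" where
  "icosahedral_axes = {vector [0, 1, 2], vector [0, -1, 2], vector [2, 0, 1],
     vector [2, 0, -1], vector [1, 2, 0], vector [-1, 2, 0]}"

lemma finite_icosahedral_axes: "finite icosahedral_axes"
  by (simp add: icosahedral_axes_def)

lemma card_icosahedral_axes: "card icosahedral_axes = 6"
  by (simp add: icosahedral_axes_def vec_eq_iff forall_3 vector_3)

lemma inner_self_icosahedral_axes: "v \<in> icosahedral_axes \<Longrightarrow> v \<bullet> v = 5"
  by (auto simp: icosahedral_axes_def inner_vec_def sum_3 vector_3)

lemma inner_icosahedral_axes_ge_2:
  "v \<in> icosahedral_axes \<Longrightarrow> w \<in> icosahedral_axes \<Longrightarrow> 2 \<le> \<bar>v \<bullet> w\<bar>"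
  by (auto simp: icosahedral_axes_def inner_vec_def sum_3 vector_3)

lemma sum_inner_icosahedral_axes_squared: "(\<Sum>v\<in>icosahedral_axes. (x \<bullet> v)\<^sup>2) = 10 * (x \<bullet> x)"
  by (simp add: icosahedral_axes_def vec_eq_iff forall_3 vector_3 inner_vec_def sum_3
      power2_eq_square algebra_simps)

lemma exists_close_icosahedral_axis:
  assumes x: "x \<in> S2"
  shows "\<exists>v\<in>icosahedral_axes. 5/4 < \<bar>x \<bullet> v\<bar>"
proof (rule ccontr)
  assume "\<not> ?thesis"
  then have "(x \<bullet> v)\<^sup>2 \<le> (5/4)\<^sup>2" if "v \<in> icosahedral_axes" for v
    using that by (intro abs_le_square_iff[THEN iffD1]) force
  then have "(\<Sum>v\<in>icosahedral_axes. (x \<bullet> v)\<^sup>2) \<le> 6 * (5/4)\<^sup>2"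
    using sum_bounded_above[of icosahedral_axes "\<lambda>v. (x \<bullet> v)\<^sup>2" "(5/4)\<^sup>2"]
    by (simp add: card_icosahedral_axes)
  moreover have "x \<bullet> x = 1"
    using x by (simp add: norm_eq_1)
  ultimately show False
    unfolding sum_inner_icosahedral_axes_squared by (simp add: power2_eq_square)
qed

lemma good_cover_icosahedral_caps:
  "good_cover real_projective_plane (projective_cap (5/4) ` icosahedral_axes)"
proof (rule good_cover_projective_caps[where n = 5])
  show "5 - 2 * (5/4)\<^sup>2 \<le> \<bar>v \<bullet> w\<bar>" if "v \<in> icosahedral_axes" "w \<in> icosahedral_axes" for v w
    using inner_icosahedral_axes_ge_2[OF that] by (simp add: power2_eq_square)
  show "\<exists>v\<in>icosahedral_axes. 5/4 < \<bar>x \<bullet> v\<bar>" if "x \<in> S2" for x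
    using that by (rule exists_close_icosahedral_axis)
qed (simp_all add: finite_icosahedral_axes inner_self_icosahedral_axes power2_eq_square)

lemma covering_type_real_projective_plane_ge_6:
  "6 \<le> covering_type TYPE('b) real_projective_plane"
proof -
  have "6 \<le> strict_covering_type X"
    if "X homotopy_equivalent_space real_projective_plane" for X :: "'b topology"
    using that good_cover_dominating_card_ge_6
    unfolding strict_covering_type_def homotopy_equivalent_space_def
    by (auto intro!: Inf_greatest simp: numeral_eq_enat)
  then show ?thesis
    unfolding covering_type_def by (auto intro: Inf_greatest)
qed

lemma strict_covering_type_real_projective_plane_le_6:
  "strict_covering_type real_projective_plane \<le> 6"
proof -
  have "strict_covering_type real_projective_plane
      \<le> enat (card (projective_cap (5/4) ` icosahedral_axes))"
    unfolding strict_covering_type_def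
    using finite_icosahedral_axes good_cover_icosahedral_caps by (intro Inf_lower) blast
  also have "\<dots> \<le> 6"
    using card_image_le[OF finite_icosahedral_axes, of "projective_cap (5/4)"]
    by (simp add: card_icosahedral_axes numeral_eq_enat)
  finally show ?thesis .
qed

theorem theorem5p4:
  shows "covering_type TYPE((real^3) set) real_projective_plane = 6 \<and>
         6 \<le> covering_type TYPE('b) real_projective_plane"
proof -
  have "covering_type TYPE((real^3) set) real_projective_plane
      \<le> strict_covering_type real_projective_plane"
    unfolding covering_type_def by (intro Inf_lower) (auto intro: homotopy_equivalent_space_refl)
  also have "\<dots> \<le> 6"
    by (rule strict_covering_type_real_projective_plane_le_6)
  finally show ?thesis
    using covering_type_real_projective_plane_ge_6 by (metis antisym)
qed

end
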